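(* Fix a feature dimension $F\ge 1$. Let $\mathrm{Comb}$ be the model class whose representation of a link $(i,j)$ in a graph $(A,X)$ is the concatenation of $$\mathrm{MPNN}(i,A,X)\odot \mathrm{MPNN}(j,A,X)$$ with finitely many features of the form $$\sum_{u\in N_{l_1}^{l_2}(i)\oplus N_{l_1'}^{l_2'}(j)} g\big((A^{l_2})_{iu}\big)\,g\big((A^{l_2'})_{ju}\big)\,\mathrm{MPNN}(u,A,X),$$ where $\mathrm{MPNN}$ is any message passing neural network, $g$ is any real-valued function, $l_1,l_2,l_1',l_2'\ge 1$ are any integers, and $\oplus$ is set intersection or set difference (in either order). Then $\mathrm{Comb}$ is strictly more expressive than each of the models GAE, CN, RA, AA, Neo-GNN and BUDDY.
   Context: Graphs. A graph is an undirected graph on $V=\{1,\dots,n\}$ ($n$ arbitrary) with symmetric adjacency matrix $A\in\{0,1\}^{n\times n}$ and node feature matrix $X\in\mathbb{R}^{n\times F}$, whose $v$-th row $X_v$ is the feature of node $v$. Write $N(u)=\{v: A_{uv}>0\}$ and $d(u)=\sum_v A_{uv}$. For $l\ge1$, $A^{l}$ is the $l$-th matrix power (its $(u,v)$ entry counts walks of length $l$), regarded also as a graph in which $u,v$ are adjacent iff $(A^l)_{uv}>0$. $N_{l_1}^{l_2}(u)$ is the set of nodes at shortest-path distance exactly $l_1$ from $u$ in the graph $A^{l_2}$. A link is a pair of distinct nodes $(i,j)$ in a graph $(A,X)$. $\odot$ is the entrywise product. MPNN. A message passing neural network with $K$ layers sets $h_v^{(0)}=X_v$ and $$h_v^{(k)}=U^{(k)}\Big(h_v^{(k-1)},\mathrm{AGG}\big(\{\!\!\{M^{(k)}(h_v^{(k-1)},h_u^{(k-1)}):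 u\in N(v)\}\!\!\}\big)\Big),\quad k=1,\dots,K,$$ with arbitrary functions $U^{(k)},M^{(k)}$ between finite-dimensional real vector spaces and $\mathrm{AGG}$ a permutation-invariant function of finite multisets (such as sum or max); $\mathrm{MPNN}(v,A,X)=h_v^{(K)}$. $K$, the dimensions and the functions are the free parameters; within one link representation the same MPNN is used throughout. Models (output on link $(i,j)$ in $(A,X)$): - GAE: $\langle \mathrm{MPNN}(i,A,X),\mathrm{MPNN}(j,A,X)\rangle$. - CN: $\sum_{u\in N(i)\cap N(j)}1$. RA: $\sum_{u\in N(i)\cap N(j)}\frac1{d(u)}$. AA: $\sum_{u\in N(i)\cap N(j)}\frac1{\log d(u)}$. - Neo-GNN: $\mathrm{MPNN}(i,A,X)\odot\mathrm{MPNN}(j,A,X)$ concatenated with finitely many features $\sum_{u\in N_1^{l_1}(i)\cap N_1^{l_2}(j)} (A^{l_1})_{iu}(A^{l_2})_{ju}\,f(d(u))$, with $f$ an arbitrary (learnable) function and $l_1,l_2\ge1$. - BUDDY: for some $k\ge1$, $\mathrm{MPNN}(i,A,X)\odot\mathrm{MPNN}(j,A,X)$ concatenated with $a_{l_1,l_2}(i,j)=|N_{l_1}^1(i)\cap N_{l_2}^1(j)|$ for $l_1,l_2=1,\dots,k$, and $b_l(i,j)=|N_l^1(i)\setminus\bigcup_{l'=1}^k N_{l'}^1(j)|$ and $b_l(j,i)$ for $l=1,\dots,k$. Expressivity. A model class differentiates (distinguishes) two links (possibly in different graphs with feature dimension $F$) if for some choice of its free parameters and hyperparameters its outputs on the two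 links differ. Model A is more expressive than model B if A differentiates every pair of links that B differentiates. A is strictly more expressive than B if A is more expressive than B and there is a pair of links that A differentiates but B does not. *)

theory Defs
  imports Complex_Main "HOL-Library.Multiset" "HOL-Library.FuncSet" "HOL-Library.Extended_Nat"
    "Jordan_Normal_Form.Matrix"
begin

text \<open>Nodes of a graph with \<open>n\<close> nodes are \<open>0, \<dots>, n - 1\<close>. Self-loops are not excluded.\<close>

definition graph :: "nat \<Rightarrow> real mat \<Rightarrow> real mat \<Rightarrow> bool" where
  "graph F A X \<longleftrightarrow> A \<in> carrier_mat (dim_row A) (dim_row A) \<and> A\<^sup>T = A \<and>
     elements_mat A \<subseteq> {0, 1} \<and> X \<in> carrier_mat (dim_row A) F"

text \<open>A nonnegative square matrix \<open>B\<close>, such as a power of an adjacency matrix, is read as the graph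
  whose edges are its positive entries.\<close>

definition edges :: "real mat \<Rightarrow> (nat \<times> nat) set" where
  "edges B = {(u, v). u < dim_row B \<and> v < dim_row B \<and> B $$ (u, v) > 0}"

definition nbrs :: "real mat \<Rightarrow> nat \<Rightarrow> nat set" where
  "nbrs A u = {v. (u, v) \<in> edges A}"

definition deg :: "real mat \<Rightarrow> nat \<Rightarrow> real" where
  "deg A u = (\<Sum>v<dim_row A. A $$ (u, v))"

text \<open>The distance is \<open>\<infinity>\<close> between disconnected nodes; a shortest walk is a shortest path.\<close>

definition spd :: "real mat \<Rightarrow> nat \<Rightarrow> nat \<Rightarrow> enat" where
  "spd B u v = (INF k \<in> {k. (u, v) \<in> edges B ^^ k}. enat k)"

text \<open>\<open>hop A l1 l2 u\<close> is \<open>N\<close> with subscript \<open>l1\<close> and superscript \<open>l2\<close>: distance \<open>l1\<close> in the graph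
  of the \<open>l2\<close>-th power of \<open>A\<close>.\<close>

definition hop :: "real mat \<Rightarrow> nat \<Rightarrow> nat \<Rightarrow> nat \<Rightarrow> nat set" where
  "hop A l1 l2 u = {v. v < dim_row A \<and> spd (A ^\<^sub>m l2) u v = enat l1}"

record link =
  adj :: "real mat"
  feat :: "real mat"
  src :: nat
  tgt :: nat

definition is_link :: "nat \<Rightarrow> link \<Rightarrow> bool" where
  "is_link F L \<longleftrightarrow> graph F (adj L) (feat L) \<and>
     src L < dim_row (adj L) \<and> tgt L < dim_row (adj L) \<and> src L \<noteq> tgt L"

text \<open>\<open>hid k\<close> is the dimension of the \<open>k\<close>-th hidden state and \<open>msg_dim k\<close> that of the messages of
  layer \<open>k\<close>. As with sum or max, the aggregator is one function of finite multisets given in every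
  dimension: \<open>agg m\<close> takes multisets of vectors of dimension \<open>m\<close> to vectors of dimension
  \<open>agg_dim m\<close>.\<close>

record mpnn =
  layers :: nat
  hid :: "nat \<Rightarrow> nat"
  msg_dim :: "nat \<Rightarrow> nat"
  agg_dim :: "nat \<Rightarrow> nat"
  msg :: "nat \<Rightarrow> real vec \<Rightarrow> real vec \<Rightarrow> real vec"
  agg :: "nat \<Rightarrow> real vec multiset \<Rightarrow> real vec"
  upd :: "nat \<Rightarrow> real vec \<Rightarrow> real vec \<Rightarrow> real vec"

definition is_mpnn :: "nat \<Rightarrow> mpnn \<Rightarrow> bool" where
  "is_mpnn F P \<longleftrightarrow> hid P 0 = F \<and>
     (\<forall>m. agg P m \<in> {S. set_mset S \<subseteq> carrier_vec m} \<rightarrow> carrier_vec (agg_dim P m)) \<and>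
     (\<forall>k\<in>{1..layers P}.
        msg P k \<in> carrier_vec (hid P (k - 1)) \<rightarrow> carrier_vec (hid P (k - 1)) \<rightarrow>
          carrier_vec (msg_dim P k) \<and>
        upd P k \<in> carrier_vec (hid P (k - 1)) \<rightarrow> carrier_vec (agg_dim P (msg_dim P k)) \<rightarrow>
          carrier_vec (hid P k))"

fun hidden :: "mpnn \<Rightarrow> real mat \<Rightarrow> real mat \<Rightarrow> nat \<Rightarrow> nat \<Rightarrow> real vec" where
  "hidden P A X 0 v = row X v"
| "hidden P A X (Suc k) v =
     upd P (Suc k) (hidden P A X k v)
       (agg P (msg_dim P (Suc k))
         (image_mset (\<lambda>u. msg P (Suc k) (hidden P A X k v) (hidden P A X k u))
           (mset_set (nbrs A v))))"

definition out_dim :: "mpnn \<Rightarrow> nat" where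
  "out_dim P = hid P (layers P)"

definition run :: "mpnn \<Rightarrow> nat \<Rightarrow> real mat \<Rightarrow> real mat \<Rightarrow> real vec" where
  "run P v A X = hidden P A X (layers P) v"

definition hadamard :: "real vec \<Rightarrow> real vec \<Rightarrow> real vec" (infixl "\<odot>" 70) where
  "v \<odot> w = vec (dim_vec v) (\<lambda>k. v $ k * w $ k)"

definition vec_concat :: "real vec list \<Rightarrow> real vec" where
  "vec_concat vs = foldr (@\<^sub>v) vs vNil"

definition pair_rep :: "mpnn \<Rightarrow> link \<Rightarrow> real vec" where
  "pair_rep P L = run P (src L) (adj L) (feat L) \<odot> run P (tgt L) (adj L) (feat L)"

text \<open>A model class is the set of the functions on links that arise from its choices of free
  parameters and hyperparameters.\<close>

definition GAE :: "nat \<Rightarrow> (link \<Rightarrow> real) set" where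
  "GAE F = {\<lambda>L. run P (src L) (adj L) (feat L) \<bullet> run P (tgt L) (adj L) (feat L) | P. is_mpnn F P}"

definition CN :: "(link \<Rightarrow> real) set" where
  "CN = {\<lambda>L. \<Sum>u \<in> nbrs (adj L) (src L) \<inter> nbrs (adj L) (tgt L). 1}"

definition RA :: "(link \<Rightarrow> real) set" where
  "RA = {\<lambda>L. \<Sum>u \<in> nbrs (adj L) (src L) \<inter> nbrs (adj L) (tgt L). 1 / deg (adj L) u}"

definition AA :: "(link \<Rightarrow> real) set" where
  "AA = {\<lambda>L. \<Sum>u \<in> nbrs (adj L) (src L) \<inter> nbrs (adj L) (tgt L). 1 / ln (deg (adj L) u)}"

definition neo_feature :: "nat \<times> nat \<times> (real \<Rightarrow> real) \<Rightarrow> link \<Rightarrow> real" where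
  "neo_feature = (\<lambda>(l1, l2, f) L. let A = adj L; i = src L; j = tgt L in
     \<Sum>u \<in> hop A 1 l1 i \<inter> hop A 1 l2 j.
       (A ^\<^sub>m l1) $$ (i, u) * (A ^\<^sub>m l2) $$ (j, u) * f (deg A u))"

definition NeoGNN :: "nat \<Rightarrow> (link \<Rightarrow> real vec) set" where
  "NeoGNN F = {\<lambda>L. pair_rep P L @\<^sub>v vec_of_list (map (\<lambda>s. neo_feature s L) specs) | P specs.
     is_mpnn F P \<and> (\<forall>(l1, l2, f) \<in> set specs. l1 \<ge> 1 \<and> l2 \<ge> 1)}"

definition buddy_a :: "real mat \<Rightarrow> nat \<Rightarrow> nat \<Rightarrow> nat \<Rightarrow> nat \<Rightarrow> real" where
  "buddy_a A l1 l2 i j = real (card (hop A l1 1 i \<inter> hop A l2 1 j))"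

definition buddy_b :: "real mat \<Rightarrow> nat \<Rightarrow> nat \<Rightarrow> nat \<Rightarrow> nat \<Rightarrow> real" where
  "buddy_b A k l i j = real (card (hop A l 1 i - (\<Union>l' \<in> {1..k}. hop A l' 1 j)))"

definition buddy_features :: "nat \<Rightarrow> link \<Rightarrow> real list" where
  "buddy_features k L = (let A = adj L; i = src L; j = tgt L in
     [buddy_a A l1 l2 i j. l1 \<leftarrow> [1..<Suc k], l2 \<leftarrow> [1..<Suc k]] @
     [buddy_b A k l i j. l \<leftarrow> [1..<Suc k]] @
     [buddy_b A k l j i. l \<leftarrow> [1..<Suc k]])"

definition BUDDY :: "nat \<Rightarrow> (link \<Rightarrow> real vec) set" where
  "BUDDY F = {\<lambda>L. pair_rep P L @\<^sub>v vec_of_list (buddy_features k L) | P k. is_mpnn F P \<and> k \<ge> 1}"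

datatype set_op = Inter | Diff | Diff_rev

fun apply_op :: "set_op \<Rightarrow> nat set \<Rightarrow> nat set \<Rightarrow> nat set" where
  "apply_op Inter S T = S \<inter> T"
| "apply_op Diff S T = S - T"
| "apply_op Diff_rev S T = T - S"

record comb_spec =
  op :: set_op
  len1 :: nat
  pow1 :: nat
  len2 :: nat
  pow2 :: nat
  weight :: "real \<Rightarrow> real"

definition is_comb_spec :: "comb_spec \<Rightarrow> bool" where
  "is_comb_spec s \<longleftrightarrow> len1 s \<ge> 1 \<and> pow1 s \<ge> 1 \<and> len2 s \<ge> 1 \<and> pow2 s \<ge> 1"

text \<open>The sum of vectors is written out by coordinates, since \<open>real vec\<close> has no common zero.\<close>

definition comb_feature :: "mpnn \<Rightarrow> comb_spec \<Rightarrow> link \<Rightarrow> real vec" where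
  "comb_feature P s L = (let A = adj L; i = src L; j = tgt L; g = weight s in
     vec (out_dim P) (\<lambda>k.
       \<Sum>u \<in> apply_op (op s) (hop A (len1 s) (pow1 s) i) (hop A (len2 s) (pow2 s) j).
         g ((A ^\<^sub>m pow1 s) $$ (i, u)) * g ((A ^\<^sub>m pow2 s) $$ (j, u)) * run P u A (feat L) $ k))"

definition Comb :: "nat \<Rightarrow> (link \<Rightarrow> real vec) set" where
  "Comb F = {\<lambda>L. pair_rep P L @\<^sub>v vec_concat (map (\<lambda>s. comb_feature P s L) specs) | P specs.
     is_mpnn F P \<and> (\<forall>s \<in> set specs. is_comb_spec s)}"

definition differentiates :: "(link \<Rightarrow> 'a) set \<Rightarrow> link \<Rightarrow> link \<Rightarrow> bool" where
  "differentiates M L L' \<longleftrightarrow> (\<exists>r\<in>M. r L \<noteq> r L')"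

definition more_expressive :: "nat \<Rightarrow> (link \<Rightarrow> 'a) set \<Rightarrow> (link \<Rightarrow> 'b) set \<Rightarrow> bool" where
  "more_expressive F M M' \<longleftrightarrow> (\<forall>L L'. is_link F L \<and> is_link F L' \<and>
     differentiates M' L L' \<longrightarrow> differentiates M L L')"

definition strictly_more_expressive :: "nat \<Rightarrow> (link \<Rightarrow> 'a) set \<Rightarrow> (link \<Rightarrow> 'b) set \<Rightarrow> bool" where
  "strictly_more_expressive F M M' \<longleftrightarrow> more_expressive F M M' \<and>
     (\<exists>L L'. is_link F L \<and> is_link F L' \<and> differentiates M L L' \<and> \<not> differentiates M' L L')"

end

theory Submission
  imports Defs
begin

text \<open>If \<open>Comb\<close> gives two links equal outputs, then for all operations, exponents, weights and every
  function \<open>f\<close> of the degree its features with \<open>MPNN(u) = f (d(u))\<close> agree on both. These features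
  contain those of Neo-GNN literally, and those of BUDDY by inclusion-exclusion. For CN, RA and AA,
  weight \<open>g(x) = x\<close> and summation over all three operations give the sum over the common neighbours,
  including \<open>i\<close> and \<open>j\<close> themselves when they carry self-loops. For strictness, take a single edge
  whose endpoints have different features and reverse the link. All the other models are invariant
  under this reversal: it is an automorphism of the unlabelled graph, and the two nodes enter the
  MPNN part symmetrically. But \<open>Comb\<close> sees the feature of \<open>N(i) - N(j) = {j}\<close>.\<close>

subsection \<open>Message passing networks\<close>

text \<open>Dimensions matter later: concatenations are compared part by part, and products of node
  vectors commute, only once the dimensions are known to agree.\<close>

lemma hidden_carrier:
  assumes "is_mpnn F P" "graph F A X" "v < dim_row A" "k \<le> layers P"
  shows "hidden P A X k v \<in> carrier_vec (hid P k)"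
  using assms(3,4)
proof (induction k arbitrary: v)
  case 0
  then show ?case
    using assms(1,2) by (auto simp: is_mpnn_def graph_def intro!: carrier_vecI)
next
  case (Suc k)
  have k: "Suc k \<in> {1..layers P}" using Suc.prems by auto
  have IH: "hidden P A X k u \<in> carrier_vec (hid P k)" if "u < dim_row A" for u
    using Suc that by simp
  \<comment> \<open>\<open>mset_set\<close> of an infinite set is empty, so both cases give only
    nodes of the graph.\<close>
  have nbr: "u < dim_row A" if "u \<in># mset_set (nbrs A v)" for u
    using that by (cases "finite (nbrs A v)") (auto simp: nbrs_def edges_def)
  have "msg P (Suc k) \<in> carrier_vec (hid P k) \<rightarrow> carrier_vec (hid P k) \<rightarrow> carrier_vec (msg_dim P (Suc k))"
    and U: "upd P (Suc k) \<in> carrier_vec (hid P k) \<rightarrow> carrier_vec (agg_dim P (msg_dim P (Suc k))) \<rightarrow>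
          carrier_vec (hid P (Suc k))"
    and G: "agg P (msg_dim P (Suc k)) \<in> {S. set_mset S \<subseteq> carrier_vec (msg_dim P (Suc k))} \<rightarrow>
          carrier_vec (agg_dim P (msg_dim P (Suc k)))"
    using assms(1) k unfolding is_mpnn_def by force+
  then have "set_mset (image_mset (\<lambda>u. msg P (Suc k) (hidden P A X k v) (hidden P A X k u))
           (mset_set (nbrs A v))) \<subseteq> carrier_vec (msg_dim P (Suc k))"
    using IH Suc.prems nbr by (fastforce simp: Pi_iff)
  then have "agg P (msg_dim P (Suc k)) (image_mset
        (\<lambda>u. msg P (Suc k) (hidden P A X k v) (hidden P A X k u)) (mset_set (nbrs A v)))
      \<in> carrier_vec (agg_dim P (msg_dim P (Suc k)))"
    using G by blast
  then show ?case using U IH Suc.prems by (simp add: Pi_iff)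
qed

lemma run_carrier:
  assumes "is_mpnn F P" "graph F A X" "v < dim_row A"
  shows "run P v A X \<in> carrier_vec (out_dim P)"
  using hidden_carrier[OF assms order_refl] by (simp add: run_def out_dim_def)

lemma pair_rep_carrier:
  assumes "is_mpnn F P" "is_link F L"
  shows "pair_rep P L \<in> carrier_vec (out_dim P)"
  using run_carrier[OF assms(1)] assms(2)
  by (auto simp: is_link_def pair_rep_def hadamard_def intro!: carrier_vecI)

text \<open>Zero layers, so that the output is the raw feature row; this network tells the endpoints
  of the separating edge apart.\<close>

definition input_mpnn :: "nat \<Rightarrow> mpnn" where
  "input_mpnn F = \<lparr>layers = 0, hid = \<lambda>_. F, msg_dim = \<lambda>_. 0, agg_dim = \<lambda>_. 0,
     msg = \<lambda>_ _ _. 0\<^sub>v 0, agg = \<lambda>_ _. 0\<^sub>v 0, upd = \<lambda>_ v _. v\<rparr>"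

lemma is_mpnn_input_mpnn: "is_mpnn F (input_mpnn F)"
  by (simp add: is_mpnn_def input_mpnn_def)

lemma run_input_mpnn: "run (input_mpnn F) v A X = row X v"
  by (simp add: run_def input_mpnn_def)

text \<open>All messages are the empty vector, so the multiset remembers only the number of
  neighbours; aggregation returns this number and the update applies \<open>f\<close> to it.\<close>

definition degree_mpnn :: "nat \<Rightarrow> (real \<Rightarrow> real) \<Rightarrow> mpnn" where
  "degree_mpnn F f = \<lparr>layers = 1, hid = \<lambda>k. if k = 0 then F else 1, msg_dim = \<lambda>_. 0,
     agg_dim = \<lambda>_. 1, msg = \<lambda>_ _ _. 0\<^sub>v 0, agg = \<lambda>_ S. vec 1 (\<lambda>_. real (size S)),
     upd = \<lambda>_ _ a. vec 1 (\<lambda>_. f (a $ 0))\<rparr>"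

lemma is_mpnn_degree_mpnn: "is_mpnn F (degree_mpnn F f)"
  by (simp add: is_mpnn_def degree_mpnn_def)

lemma graph_entry:
  assumes "graph F A X" "u < dim_row A" "v < dim_row A"
  shows "A $$ (u, v) = (if v \<in> nbrs A u then 1 else 0)"
proof -
  have "A $$ (u, v) \<in> elements_mat A"
    using assms by (intro elements_matI[of A "dim_row A" "dim_row A"]) (auto simp: graph_def)
  then have "A $$ (u, v) = 0 \<or> A $$ (u, v) = 1" using assms(1) by (auto simp: graph_def)
  then show ?thesis using assms by (auto simp: nbrs_def edges_def)
qed

lemma nbrs_subset: "nbrs A u \<subseteq> {..<dim_row A}"
  by (auto simp: nbrs_def edges_def)

text \<open>Entries are 0 or 1, so a row sum counts neighbours; this ties \<open>deg\<close> to the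
  multiset size that \<open>degree_mpnn\<close> computes.\<close>

lemma deg_eq_card_nbrs:
  assumes "graph F A X" "u < dim_row A"
  shows "deg A u = real (card (nbrs A u))"
proof -
  have "deg A u = (\<Sum>v<dim_row A. if v \<in> nbrs A u then 1 else 0)"
    using graph_entry[OF assms] by (simp add: deg_def)
  also have "\<dots> = real (card (nbrs A u))"
    using nbrs_subset[of A u] by (simp add: sum.If_cases Int_absorb1)
  finally show ?thesis .
qed

lemma run_degree_mpnn:
  assumes "graph F A X" "u < dim_row A"
  shows "run (degree_mpnn F f) u A X = vec 1 (\<lambda>_. f (deg A u))"
  by (simp add: run_def degree_mpnn_def deg_eq_card_nbrs[OF assms])

subsection \<open>Hop neighbourhoods\<close>

lemma hop_subset: "hop A l1 l2 u \<subseteq> {..<dim_row A}"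
  by (auto simp: hop_def)

lemma finite_hop [simp, intro]: "finite (hop A l1 l2 u)"
  by (rule finite_subset[OF hop_subset]) simp

lemma hop_disjoint: "l \<noteq> l' \<Longrightarrow> hop A l m u \<inter> hop A l' m u = {}"
  by (auto simp: hop_def)

lemma self_notin_hop: "l \<ge> 1 \<Longrightarrow> u \<notin> hop A l m u"
proof -
  have "spd (A ^\<^sub>m m) u u \<le> enat 0"
    unfolding spd_def by (rule INF_lower) simp
  then show "l \<ge> 1 \<Longrightarrow> u \<notin> hop A l m u" by (auto simp: hop_def zero_enat_def)
qed

lemma spd_edge:
  assumes "(u, v) \<in> edges B" "u \<noteq> v"
  shows "spd B u v = enat 1"
proof (rule antisym)
  show "spd B u v \<le> enat 1"
    unfolding spd_def using assms(1) by (intro INF_lower) simp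
  show "enat 1 \<le> spd B u v"
    unfolding spd_def
  proof (rule INF_greatest)
    fix k assume "k \<in> {k. (u, v) \<in> edges B ^^ k}"
    then have "k \<noteq> 0" using assms(2) by (auto intro: ccontr)
    then show "enat 1 \<le> enat k" by simp
  qed
qed

lemma nbr_in_hop:
  assumes "graph F A X" "v \<in> nbrs A u" "u \<noteq> v"
  shows "v \<in> hop A 1 1 u"
proof -
  have "A ^\<^sub>m 1 = A" using assms(1) by (auto simp: graph_def)
  moreover have "spd A u v = enat 1" using assms by (intro spd_edge) (auto simp: nbrs_def)
  ultimately show ?thesis using assms by (auto simp: hop_def nbrs_def edges_def)
qed

subsection \<open>Comb subsumes the other models\<close>

lemma append_vNil_right [simp]: "v @\<^sub>v vNil = v"
  by (intro eq_vecI) auto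

lemma Comb_memI:
  assumes "is_mpnn F P" "\<forall>s \<in> set specs. is_comb_spec s"
  shows "(\<lambda>L. pair_rep P L @\<^sub>v vec_concat (map (\<lambda>s. comb_feature P s L) specs)) \<in> Comb F"
  using assms unfolding Comb_def by blast

lemma differentiates_Comb_pair_rep:
  assumes "is_mpnn F P" "pair_rep P L \<noteq> pair_rep P L'"
  shows "differentiates (Comb F) L L'"
  using Comb_memI[OF assms(1), of "[]"] assms(2)
  by (auto simp: differentiates_def vec_concat_def)

text \<open>The pair parts have equal dimension, so a difference in the one feature behind them
  survives concatenation.\<close>

lemma differentiates_Comb_feature:
  assumes "is_mpnn F P" "is_comb_spec s" "is_link F L" "is_link F L'"
    and "comb_feature P s L \<noteq> comb_feature P s L'"
  shows "differentiates (Comb F) L L'"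
  unfolding differentiates_def
proof (rule bexI)
  show "(\<lambda>L. pair_rep P L @\<^sub>v vec_concat (map (\<lambda>s. comb_feature P s L) [s])) \<in> Comb F"
    using assms by (intro Comb_memI) auto
  show "pair_rep P L @\<^sub>v vec_concat (map (\<lambda>s. comb_feature P s L) [s]) \<noteq>
      pair_rep P L' @\<^sub>v vec_concat (map (\<lambda>s. comb_feature P s L') [s])"
    using assms(5) append_vec_eq[OF pair_rep_carrier[OF assms(1,3)] pair_rep_carrier[OF assms(1,4)]]
    by (simp add: vec_concat_def)
qed

text \<open>The sole coordinate of \<open>comb_feature\<close> for the network
  \<open>degree_mpnn F f\<close>.\<close>

definition degree_sum :: "comb_spec \<Rightarrow> (real \<Rightarrow> real) \<Rightarrow> link \<Rightarrow> real" where
  "degree_sum s f L = (let A = adj L; i = src L; j = tgt L; g = weight s in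
     \<Sum>u \<in> apply_op (op s) (hop A (len1 s) (pow1 s) i) (hop A (len2 s) (pow2 s) j).
       g ((A ^\<^sub>m pow1 s) $$ (i, u)) * g ((A ^\<^sub>m pow2 s) $$ (j, u)) * f (deg A u))"

lemma apply_op_subset: "apply_op oper S T \<subseteq> S \<union> T"
  by (cases oper) auto

lemma comb_feature_degree_mpnn:
  assumes "is_link F L"
  shows "comb_feature (degree_mpnn F f) s L = vec 1 (\<lambda>_. degree_sum s f L)"
proof -
  have gr: "graph F (adj L) (feat L)" using assms by (simp add: is_link_def)
  have "u < dim_row (adj L)" if "u \<in> apply_op (op s) (hop (adj L) (len1 s) (pow1 s) (src L))
      (hop (adj L) (len2 s) (pow2 s) (tgt L))" for u
    using that apply_op_subset hop_subset by blast
  moreover have "out_dim (degree_mpnn F f) = 1" by (simp add: out_dim_def degree_mpnn_def)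
  ultimately show ?thesis
    unfolding comb_feature_def degree_sum_def Let_def
    by (auto simp: run_degree_mpnn[OF gr] intro!: sum.cong)
qed

text \<open>Running \<open>degree_mpnn F f\<close> turns the assumption on Comb into one equality
  for each \<open>f\<close>; the structural features of the other models are built from such
  sums.\<close>

lemma degree_sum_eq:
  assumes "\<not> differentiates (Comb F) L L'" "is_link F L" "is_link F L'" "is_comb_spec s"
  shows "degree_sum s f L = degree_sum s f L'"
proof -
  have "comb_feature (degree_mpnn F f) s L = comb_feature (degree_mpnn F f) s L'"
    using differentiates_Comb_feature[OF is_mpnn_degree_mpnn] assms by blast
  then have "vec 1 (\<lambda>_. degree_sum s f L) $ 0 = vec 1 (\<lambda>_. degree_sum s f L') $ 0"
    using assms by (simp add: comb_feature_degree_mpnn)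
  then show ?thesis by simp
qed

text \<open>A common neighbour equal to \<open>i\<close> or \<open>j\<close> (through a self-loop) has distance 0 from that node,
  so it lies in one of the two differences instead of the intersection.\<close>

lemma common_nbrs_sum:
  assumes "is_link F L"
  shows "(\<Sum>u \<in> nbrs (adj L) (src L) \<inter> nbrs (adj L) (tgt L). f (deg (adj L) u)) =
    (\<Sum>oper \<in> {Inter, Diff, Diff_rev}.
      degree_sum \<lparr>op = oper, len1 = 1, pow1 = 1, len2 = 1, pow2 = 1, weight = \<lambda>x. x\<rparr> f L)"
proof -
  define A where "A = adj L"
  define i where "i = src L"
  define j where "j = tgt L"
  have gr: "graph F A (feat L)" and i: "i < dim_row A" and j: "j < dim_row A" and ij: "i \<noteq> j"
    using assms by (auto simp: is_link_def A_def i_def j_def)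
  have A1: "A ^\<^sub>m 1 = A" using gr by (auto simp: graph_def)
  let ?S = "hop A 1 1 i" and ?T = "hop A 1 1 j"
  let ?h = "\<lambda>u. A $$ (i, u) * A $$ (j, u) * f (deg A u)"
  \<comment> \<open>On a common neighbour both entries are 1, so they can be inserted as weights;
    elsewhere one of them is 0, which lets the sum run over the union of the hop sets.\<close>
  have "(\<Sum>u \<in> nbrs A i \<inter> nbrs A j. f (deg A u)) = sum ?h (nbrs A i \<inter> nbrs A j)"
    using graph_entry[OF gr] i j nbrs_subset[of A i] by (intro sum.cong) (auto simp: subset_iff)
  also have "\<dots> = sum ?h (?S \<union> ?T)"
  proof (rule sum.mono_neutral_left)
    show "nbrs A i \<inter> nbrs A j \<subseteq> ?S \<union> ?T"
      using nbr_in_hop[OF gr] ij by blast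
    show "\<forall>u \<in> ?S \<union> ?T - nbrs A i \<inter> nbrs A j. ?h u = 0"
    proof
      fix u assume u: "u \<in> ?S \<union> ?T - nbrs A i \<inter> nbrs A j"
      then have "u < dim_row A" using hop_subset by blast
      then show "?h u = 0"
        using u graph_entry[OF gr i] graph_entry[OF gr j] by auto
    qed
  qed auto
  also have "?S \<union> ?T = (?S \<inter> ?T) \<union> (?S - ?T) \<union> (?T - ?S)" by blast
  also have "sum ?h \<dots> = sum ?h (?S \<inter> ?T) + sum ?h (?S - ?T) + sum ?h (?T - ?S)"
  proof -
    have "sum ?h ((?S \<inter> ?T) \<union> (?S - ?T) \<union> (?T - ?S)) =
        sum ?h ((?S \<inter> ?T) \<union> (?S - ?T)) + sum ?h (?T - ?S)"
      by (rule sum.union_disjoint) auto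
    also have "sum ?h ((?S \<inter> ?T) \<union> (?S - ?T)) = sum ?h (?S \<inter> ?T) + sum ?h (?S - ?T)"
      by (rule sum.union_disjoint) auto
    finally show ?thesis .
  qed
  finally show ?thesis
    using A1 by (simp add: degree_sum_def Let_def A_def i_def j_def add.assoc)
qed

text \<open>For \<open>f d\<close> equal to 1, \<open>1 / d\<close> and \<open>1 / ln d\<close> the
  class on the right is CN, RA and AA.\<close>

lemma Comb_more_expressive_common_nbrs:
  fixes f :: "real \<Rightarrow> real"
  shows "more_expressive F (Comb F)
     {\<lambda>L. \<Sum>u \<in> nbrs (adj L) (src L) \<inter> nbrs (adj L) (tgt L). f (deg (adj L) u)}"
proof -
  have "(\<Sum>u \<in> nbrs (adj L) (src L) \<inter> nbrs (adj L) (tgt L). f (deg (adj L) u)) =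
      (\<Sum>u \<in> nbrs (adj L') (src L') \<inter> nbrs (adj L') (tgt L'). f (deg (adj L') u))"
    if "\<not> differentiates (Comb F) L L'" "is_link F L" "is_link F L'" for L L'
    unfolding common_nbrs_sum[OF that(2), of f] common_nbrs_sum[OF that(3), of f]
    using degree_sum_eq[OF that] by (intro sum.cong) (auto simp: is_comb_spec_def)
  then show ?thesis
    by (fastforce simp: more_expressive_def differentiates_def[of "{_}"])
qed

text \<open>The inner product is the coordinate sum of the Hadamard product, hence a function of
  \<open>pair_rep\<close> for the same network.\<close>

lemma Comb_more_expressive_GAE: "more_expressive F (Comb F) (GAE F)"
  unfolding more_expressive_def
proof (intro allI impI)
  fix L L' assume *: "is_link F L \<and> is_link F L' \<and> differentiates (GAE F) L L'"
  then obtain P where P: "is_mpnn F P"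
    and ne: "run P (src L) (adj L) (feat L) \<bullet> run P (tgt L) (adj L) (feat L) \<noteq>
      run P (src L') (adj L') (feat L') \<bullet> run P (tgt L') (adj L') (feat L')"
    by (auto simp: differentiates_def GAE_def)
  have dot: "run P (src M) (adj M) (feat M) \<bullet> run P (tgt M) (adj M) (feat M) =
      (\<Sum>k<dim_vec (pair_rep P M). pair_rep P M $ k)" if "is_link F M" for M
    using run_carrier[OF P, of "adj M" "feat M" "src M"]
      run_carrier[OF P, of "adj M" "feat M" "tgt M"] that
    by (auto simp: scalar_prod_def pair_rep_def hadamard_def is_link_def lessThan_atLeast0)
  have "pair_rep P L \<noteq> pair_rep P L'"
    using ne dot * by metis
  then show "differentiates (Comb F) L L'"
    by (rule differentiates_Comb_pair_rep[OF P])
qed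

text \<open>By contraposition: if all Comb representations agree, the pair part can be compared
  through \<open>P\<close> and each structural feature through its own degree network. No single
  Comb output has to reproduce the whole Neo-GNN output.\<close>

lemma Comb_more_expressive_NeoGNN: "more_expressive F (Comb F) (NeoGNN F)"
proof -
  have "r L = r L'" if nd: "\<not> differentiates (Comb F) L L'" "is_link F L" "is_link F L'"
    and r_in: "r \<in> NeoGNN F" for r L L'
  proof -
    obtain P specs where P: "is_mpnn F P"
      and r: "r = (\<lambda>L. pair_rep P L @\<^sub>v vec_of_list (map (\<lambda>s. neo_feature s L) specs))"
      and specs: "\<forall>(l1, l2, f) \<in> set specs. l1 \<ge> 1 \<and> l2 \<ge> 1"
      using r_in by (auto simp: NeoGNN_def)
    have "neo_feature s L = neo_feature s L'" if s: "s \<in> set specs" for s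
    proof -
      obtain l1 l2 f where "s = (l1, l2, f)" by (cases s)
      \<comment> \<open>Neo-GNN multiplies by the walk counts themselves, hence the identity weight;
        its hop sets have distance 1 in the powers \<open>l1\<close> and \<open>l2\<close>.\<close>
      then show ?thesis
        using specs s degree_sum_eq[OF nd, of "\<lparr>op = Inter, len1 = 1, pow1 = l1, len2 = 1,
          pow2 = l2, weight = \<lambda>x. x\<rparr>" f]
        by (auto simp: neo_feature_def degree_sum_def Let_def is_comb_spec_def)
    qed
    then have "vec_of_list (map (\<lambda>s. neo_feature s L) specs) =
        vec_of_list (map (\<lambda>s. neo_feature s L') specs)"
      by (intro arg_cong[where f = vec_of_list] map_cong) auto
    moreover have "pair_rep P L = pair_rep P L'"
      using differentiates_Comb_pair_rep[OF P] nd(1) by blast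
    ultimately show ?thesis unfolding r by simp
  qed
  then show ?thesis
    by (fastforce simp: more_expressive_def differentiates_def[of "NeoGNN F"])
qed

text \<open>The hop sets of \<open>j\<close> at different distances are disjoint, so removing their
  union from \<open>hop A l 1 i\<close> removes a sum of \<open>buddy_a\<close> counts. The size of
  \<open>hop A l 1 i\<close> is obtained by splitting it along \<open>hop A 1 1 j\<close>, which
  leaves only intersections and differences.\<close>

lemma buddy_b_eq:
  "buddy_b A k l i j = real (card (hop A l 1 i \<inter> hop A 1 1 j)) +
     real (card (hop A l 1 i - hop A 1 1 j)) - (\<Sum>l'=1..k. buddy_a A l l' i j)"
proof -
  let ?S = "hop A l 1 i" and ?U = "\<Union>l'\<in>{1..k}. hop A l' 1 j"
  have split: "card ?S = card (?S \<inter> T) + card (?S - T)" for T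
    by (simp add: card_Int_Diff)
  have "card (?S \<inter> ?U) = card (\<Union>l'\<in>{1..k}. ?S \<inter> hop A l' 1 j)"
    by (rule arg_cong[of _ _ card]) blast
  also have "\<dots> = (\<Sum>l'=1..k. card (?S \<inter> hop A l' 1 j))"
    using hop_disjoint[of _ _ A 1 j] by (intro card_UN_disjoint) blast+
  finally have "real (card (?S \<inter> ?U)) = (\<Sum>l'=1..k. buddy_a A l l' i j)"
    by (simp add: buddy_a_def)
  moreover have "real (card (?S - ?U)) = real (card ?S) - real (card (?S \<inter> ?U))"
    using split[of ?U] by simp
  moreover have "real (card ?S) = real (card (?S \<inter> hop A 1 1 j)) + real (card (?S - hop A 1 1 j))"
    using split[of "hop A 1 1 j"] by simp
  ultimately show ?thesis unfolding buddy_b_def by linarith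
qed

lemma buddy_a_swap: "buddy_a A l1 l2 i j = buddy_a A l2 l1 j i"
  by (simp add: buddy_a_def Int_commute)

lemma buddy_features_cong:
  assumes "\<And>l1 l2. l1 \<ge> 1 \<Longrightarrow> l2 \<ge> 1 \<Longrightarrow>
      buddy_a (adj L) l1 l2 (src L) (tgt L) = buddy_a (adj L') l1 l2 (src L') (tgt L')"
    and "\<And>l. l \<ge> 1 \<Longrightarrow>
      buddy_b (adj L) k l (src L) (tgt L) = buddy_b (adj L') k l (src L') (tgt L')"
    and "\<And>l. l \<ge> 1 \<Longrightarrow>
      buddy_b (adj L) k l (tgt L) (src L) = buddy_b (adj L') k l (tgt L') (src L')"
  shows "buddy_features k L = buddy_features k L'"
  unfolding buddy_features_def Let_def
  by (intro arg_cong2[where f = "(@)"] arg_cong[where f = concat] map_cong refl assms) auto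

lemma Comb_more_expressive_BUDDY: "more_expressive F (Comb F) (BUDDY F)"
proof -
  have "r L = r L'" if nd: "\<not> differentiates (Comb F) L L'" "is_link F L" "is_link F L'"
    and r_in: "r \<in> BUDDY F" for r L L'
  proof -
    obtain P k where P: "is_mpnn F P"
      and r: "r = (\<lambda>L. pair_rep P L @\<^sub>v vec_of_list (buddy_features k L))"
      using r_in by (auto simp: BUDDY_def)
    \<comment> \<open>Weight and degree function constantly 1 turn \<open>degree_sum\<close> into a
      cardinality.\<close>
    have card_eq: "card (apply_op oper (hop (adj L) l1 1 (src L)) (hop (adj L) l2 1 (tgt L))) =
        card (apply_op oper (hop (adj L') l1 1 (src L')) (hop (adj L') l2 1 (tgt L')))"
      if "l1 \<ge> 1" "l2 \<ge> 1" for oper l1 l2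
      using degree_sum_eq[OF nd, of "\<lparr>op = oper, len1 = l1, pow1 = 1, len2 = l2,
          pow2 = 1, weight = \<lambda>_. 1\<rparr>" "\<lambda>_. 1"] that
      by (simp add: degree_sum_def Let_def is_comb_spec_def)
    have a: "buddy_a (adj L) l1 l2 (src L) (tgt L) = buddy_a (adj L') l1 l2 (src L') (tgt L')"
      if "l1 \<ge> 1" "l2 \<ge> 1" for l1 l2
      using card_eq[OF that, of Inter] by (simp add: buddy_a_def)
    have "buddy_features k L = buddy_features k L'"
    proof (rule buddy_features_cong[OF a])
      fix l :: nat assume l: "l \<ge> 1"
      show "buddy_b (adj L) k l (src L) (tgt L) = buddy_b (adj L') k l (src L') (tgt L')"
        using card_eq[OF l order_refl, of Inter] card_eq[OF l order_refl, of Diff] a l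
        by (simp add: buddy_b_eq)
      \<comment> \<open>With the endpoints exchanged, the required difference is
        \<open>Diff_rev\<close> and the \<open>buddy_a\<close> counts swap their indices.\<close>
      show "buddy_b (adj L) k l (tgt L) (src L) = buddy_b (adj L') k l (tgt L') (src L')"
        using card_eq[OF order_refl l, of Inter] card_eq[OF order_refl l, of Diff_rev] a l
        by (simp add: buddy_b_eq buddy_a_swap[of _ l _ "tgt _"] Int_commute)
    qed
    moreover have "pair_rep P L = pair_rep P L'"
      using differentiates_Comb_pair_rep[OF P] nd(1) by blast
    ultimately show ?thesis unfolding r by simp
  qed
  then show ?thesis
    by (fastforce simp: more_expressive_def differentiates_def[of "BUDDY F"])
qed

subsection \<open>Automorphisms of the adjacency matrix\<close>

text \<open>An automorphism of the unlabelled graph: node features may change under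
  \<open>p\<close>, which the separating pair exploits.\<close>

locale automorphism =
  fixes A :: "real mat" and p :: "nat \<Rightarrow> nat"
  assumes square: "A \<in> carrier_mat (dim_row A) (dim_row A)"
    and perm: "p permutes {..<dim_row A}"
    and invariant: "u < dim_row A \<Longrightarrow> v < dim_row A \<Longrightarrow> A $$ (p u, p v) = A $$ (u, v)"
begin

lemma less_iff [simp]: "p u < dim_row A \<longleftrightarrow> u < dim_row A"
  using permutes_in_image[OF perm, of u] by simp

lemma bij: "bij p"
  using perm by (rule permutes_bij)

lemma eq_iff: "p u = p v \<longleftrightarrow> u = v"
  using bij by (simp add: bij_def inj_eq)

lemma pow_entry:
  "u < dim_row A \<Longrightarrow> v < dim_row A \<Longrightarrow> (A ^\<^sub>m k) $$ (p u, p v) = (A ^\<^sub>m k) $$ (u, v)"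
proof (induction k arbitrary: v)
  case 0
  then show ?case by (simp add: eq_iff)
next
  case (Suc k)
  have dims: "dim_row (A ^\<^sub>m k) = dim_row A" "dim_col (A ^\<^sub>m k) = dim_row A" "dim_col A = dim_row A"
    using pow_carrier_mat[OF square, of k] square by (blast dest: carrier_matD)+
  have mult: "(A ^\<^sub>m Suc k) $$ (x, y) = (\<Sum>w<dim_row A. (A ^\<^sub>m k) $$ (x, w) * A $$ (w, y))"
    if "x < dim_row A" "y < dim_row A" for x y
    using that dims by (simp add: scalar_prod_def lessThan_atLeast0)
  \<comment> \<open>The sum over the intermediate node \<open>w\<close> is reindexed along
    \<open>p\<close>.\<close>
  have "(A ^\<^sub>m Suc k) $$ (p u, p v) = (\<Sum>w<dim_row A. (A ^\<^sub>m k) $$ (p u, p w) * A $$ (p w, p v))"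
    using Suc.prems sum.permute[OF perm, of "\<lambda>w. (A ^\<^sub>m k) $$ (p u, w) * A $$ (w, p v)"]
    by (simp add: mult comp_def del: pow_mat.simps)
  also have "\<dots> = (A ^\<^sub>m Suc k) $$ (u, v)"
    using Suc by (auto simp: mult invariant simp del: pow_mat.simps intro!: sum.cong)
  finally show ?case .
qed

lemma edges_iff: "(p u, p v) \<in> edges (A ^\<^sub>m k) \<longleftrightarrow> (u, v) \<in> edges (A ^\<^sub>m k)"
proof -
  have "dim_row (A ^\<^sub>m k) = dim_row A"
    using pow_carrier_mat[OF square, of k] by simp
  then show ?thesis using pow_entry[of u v k] by (auto simp: edges_def)
qed

lemma walk_iff: "(p u, p v) \<in> edges (A ^\<^sub>m k) ^^ m \<longleftrightarrow> (u, v) \<in> edges (A ^\<^sub>m k) ^^ m"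
proof (induction m arbitrary: v)
  case 0
  then show ?case by (simp add: eq_iff)
next
  case (Suc m)
  have "(p u, p v) \<in> edges (A ^\<^sub>m k) ^^ Suc m \<longleftrightarrow>
      (\<exists>w. (p u, w) \<in> edges (A ^\<^sub>m k) ^^ m \<and> (w, p v) \<in> edges (A ^\<^sub>m k))"
    by auto
  \<comment> \<open>\<open>p\<close> is a bijection of all naturals, being the identity off the
    graph, so every intermediate node has the form \<open>p w\<close>.\<close>
  also have "\<dots> \<longleftrightarrow>
      (\<exists>w. (p u, p w) \<in> edges (A ^\<^sub>m k) ^^ m \<and> (p w, p v) \<in> edges (A ^\<^sub>m k))"
    using bij by (metis bij_pointE)
  also have "\<dots> \<longleftrightarrow> (u, v) \<in> edges (A ^\<^sub>m k) ^^ Suc m"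
    using Suc by (auto simp: edges_iff)
  finally show ?case .
qed

lemma spd_eq: "spd (A ^\<^sub>m k) (p u) (p v) = spd (A ^\<^sub>m k) u v"
  by (simp add: spd_def walk_iff)

lemma hop_image: "hop A l1 l2 (p u) = p ` hop A l1 l2 u"
proof -
  have "w \<in> hop A l1 l2 (p u) \<Longrightarrow> w \<in> p ` hop A l1 l2 u" for w
    using bij by (auto simp: hop_def spd_eq image_iff elim!: bij_pointE[of p w])
  then show ?thesis by (auto simp: hop_def spd_eq)
qed

lemma deg_eq: "u < dim_row A \<Longrightarrow> deg A (p u) = deg A u"
  using sum.permute[OF perm, of "\<lambda>v. A $$ (p u, v)"]
  by (simp add: deg_def comp_def invariant)

text \<open>Hop sets become images under \<open>p\<close>, while entries of matrix powers and
  degrees are unchanged, so the sum is merely reindexed.\<close>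

lemma neo_feature_eq:
  assumes "adj L = A" "adj L' = A" "src L' = p (src L)" "tgt L' = p (tgt L)"
    and "src L < dim_row A" "tgt L < dim_row A"
  shows "neo_feature s L' = neo_feature s L"
proof -
  obtain l1 l2 f where s: "s = (l1, l2, f)" by (cases s)
  have inj: "inj p" using bij by (rule bij_is_inj)
  let ?S = "hop A 1 l1 (src L) \<inter> hop A 1 l2 (tgt L)"
  have "hop A 1 l1 (src L') \<inter> hop A 1 l2 (tgt L') = p ` ?S"
    using assms inj by (simp add: hop_image image_Int)
  moreover have "u < dim_row A" if "u \<in> ?S" for u
    using that hop_subset by blast
  ultimately show ?thesis
    using assms inj
    by (simp add: s neo_feature_def Let_def sum.reindex inj_on_subset[OF inj] pow_entry deg_eq)
qed

text \<open>Taking images under an injective map commutes with intersections and differences and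
  preserves cardinality.\<close>

lemma buddy_features_eq:
  assumes "adj L = A" "adj L' = A" "src L' = p (src L)" "tgt L' = p (tgt L)"
  shows "buddy_features k L' = buddy_features k L"
proof -
  have inj: "inj p" using bij by (rule bij_is_inj)
  have "buddy_a A l1 l2 (p i) (p j) = buddy_a A l1 l2 i j" for l1 l2 i j
    using inj by (simp add: buddy_a_def hop_image image_Int[symmetric] card_image inj_on_subset)
  moreover have "buddy_b A k l (p i) (p j) = buddy_b A k l i j" for l i j
    using inj by (simp add: buddy_b_def hop_image image_UN[symmetric] image_set_diff[symmetric]
        card_image inj_on_subset)
  ultimately show ?thesis using assms by (intro buddy_features_cong) simp_all
qed

end

subsection \<open>The separating pair of links\<close>

text \<open>Graph and features do not depend on \<open>i\<close> and \<open>j\<close>, so both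
  orientations share every node output of a network. The different features of the two nodes leave
  Comb something to see.\<close>

definition edge_link :: "nat \<Rightarrow> nat \<Rightarrow> nat \<Rightarrow> link" where
  "edge_link F i j = \<lparr>adj = mat 2 2 (\<lambda>(u, v). if u = v then 0 else 1),
     feat = mat 2 F (\<lambda>(u, _). if u = 0 then 1 else 0), src = i, tgt = j\<rparr>"

abbreviation "L01 F \<equiv> edge_link F 0 1"
abbreviation "L10 F \<equiv> edge_link F 1 0"

lemma is_link_edge_link: "i < 2 \<Longrightarrow> j < 2 \<Longrightarrow> i \<noteq> j \<Longrightarrow> is_link F (edge_link F i j)"
  by (auto simp: is_link_def graph_def edge_link_def elements_mat_def split: if_splits)

lemma automorphism_edge: "automorphism (adj (edge_link F i j)) (Transposition.transpose 0 1)"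
  by unfold_locales
    (auto simp: edge_link_def less_2_cases_iff intro!: permutes_swap_id)

lemma pair_rep_edge_swap:
  assumes "is_mpnn F P"
  shows "pair_rep P (L10 F) = pair_rep P (L01 F)"
proof -
  note l = is_link_edge_link[of 0 1 F]
  \<comment> \<open>\<open>\<odot>\<close> takes its dimension from the left factor, so commuting it
    needs node vectors of equal dimension.\<close>
  have "run P v (adj (L01 F)) (feat (L01 F)) \<in> carrier_vec (out_dim P)" if "v < 2" for v
    using run_carrier[OF assms] l that by (auto simp: is_link_def edge_link_def)
  from this[of 0] this[of 1] show ?thesis
    by (auto simp: pair_rep_def hadamard_def edge_link_def mult.commute)
qed

lemma neo_feature_edge_swap: "neo_feature s (L10 F) = neo_feature s (L01 F)"
  by (rule automorphism.neo_feature_eq[OF automorphism_edge[of F 0 1]]) (simp_all add: edge_link_def)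

lemma hop_edge:
  assumes "{i, j} = {0, 1}"
  shows "hop (adj (edge_link F i' j')) 1 1 i = {j}"
proof -
  let ?A = "adj (edge_link F i' j')"
  have gr: "graph F ?A (feat (edge_link F i' j'))"
    using is_link_edge_link[of 0 1 F] by (simp add: is_link_def edge_link_def)
  have ij: "i \<noteq> j" "i < 2" "j < 2" using assms by (auto simp: doubleton_eq_iff)
  then have "j \<in> hop ?A 1 1 i"
    by (intro nbr_in_hop[OF gr]) (auto simp: nbrs_def edges_def edge_link_def)
  moreover have "hop ?A 1 1 i \<subseteq> {0, 1} - {i}"
    using hop_subset[of ?A 1 1 i] self_notin_hop[of 1 i ?A 1] by (fastforce simp: edge_link_def)
  ultimately show ?thesis using assms by (auto simp: doubleton_eq_iff)
qed

lemma Comb_differentiates_edge: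
  assumes "F \<ge> 1"
  shows "differentiates (Comb F) (L01 F) (L10 F)"
proof -
  \<comment> \<open>The difference of the two hop sets contains only the target, so weight 1 yields
    the raw feature of the target: zeros at node 1, ones at node 0. \<open>F \<ge> 1\<close>
    provides the coordinate 0 at which they are compared.\<close>
  define s where "s = \<lparr>op = Diff, len1 = 1, pow1 = 1, len2 = 1, pow2 = 1, weight = \<lambda>_. 1 :: real\<rparr>"
  have od: "out_dim (input_mpnn F) = F" by (simp add: out_dim_def input_mpnn_def)
  have h: "hop (adj (edge_link F i j)) 1 1 0 = {1}" "hop (adj (edge_link F i j)) 1 1 1 = {0}"
    for i j
    using hop_edge[of 0 1] hop_edge[of 1 0] by (simp_all add: insert_commute)
  have "comb_feature (input_mpnn F) s (L01 F) $ 0 = 0"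
    using assms h[of 0 1]
    by (simp add: comb_feature_def s_def od run_input_mpnn) (simp add: edge_link_def)
  moreover have "comb_feature (input_mpnn F) s (L10 F) $ 0 = 1"
    using assms h[of 1 0]
    by (simp add: comb_feature_def s_def od run_input_mpnn) (simp add: edge_link_def)
  ultimately have "comb_feature (input_mpnn F) s (L01 F) \<noteq> comb_feature (input_mpnn F) s (L10 F)"
    by (metis zero_neq_one)
  then show ?thesis
    by (intro differentiates_Comb_feature[OF is_mpnn_input_mpnn, of s] is_link_edge_link)
      (auto simp: s_def is_comb_spec_def)
qed

text \<open>One pair of links separates Comb from all six models, so strictness reduces to
  invariance under reversing this edge.\<close>

lemma strictly_more_expressive_CombI:
  assumes "F \<ge> 1" "more_expressive F (Comb F) M"
    and "\<And>r. r \<in> M \<Longrightarrow> r (L01 F) = r (L10 F)"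
  shows "strictly_more_expressive F (Comb F) M"
  unfolding strictly_more_expressive_def
proof (intro conjI exI)
  show "\<not> differentiates M (L01 F) (L10 F)"
    using assms(3) by (auto simp: differentiates_def)
qed (use assms Comb_differentiates_edge in \<open>auto intro!: is_link_edge_link\<close>)

text \<open>The set of common neighbours is symmetric in the endpoints, so reversing the link leaves
  the sum unchanged.\<close>

lemma Comb_strictly_more_expressive_common_nbrs:
  fixes f :: "real \<Rightarrow> real"
  assumes "F \<ge> 1"
  shows "strictly_more_expressive F (Comb F)
     {\<lambda>L. \<Sum>u \<in> nbrs (adj L) (src L) \<inter> nbrs (adj L) (tgt L). f (deg (adj L) u)}"
  using Comb_more_expressive_common_nbrs
  by (rule strictly_more_expressive_CombI[OF assms]) (auto simp: edge_link_def Int_commute)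

theorem theorem1:
  fixes F :: nat
  assumes "F \<ge> 1"
  shows "strictly_more_expressive F (Comb F) (GAE F) \<and>
    strictly_more_expressive F (Comb F) CN \<and>
    strictly_more_expressive F (Comb F) RA \<and>
    strictly_more_expressive F (Comb F) AA \<and>
    strictly_more_expressive F (Comb F) (NeoGNN F) \<and>
    strictly_more_expressive F (Comb F) (BUDDY F)"
proof (intro conjI)
  show "strictly_more_expressive F (Comb F) CN"
    using Comb_strictly_more_expressive_common_nbrs[OF assms, of "\<lambda>_. 1"] by (simp add: CN_def)
  show "strictly_more_expressive F (Comb F) RA"
    using Comb_strictly_more_expressive_common_nbrs[OF assms, of "\<lambda>d. 1 / d"] by (simp add: RA_def)
  show "strictly_more_expressive F (Comb F) AA"
    using Comb_strictly_more_expressive_common_nbrs[OF assms, of "\<lambda>d. 1 / ln d"]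
    by (simp add: AA_def)
  show "strictly_more_expressive F (Comb F) (GAE F)"
  proof (rule strictly_more_expressive_CombI[OF assms Comb_more_expressive_GAE])
    fix r assume "r \<in> GAE F"
    then obtain P where P: "is_mpnn F P"
      and r: "r = (\<lambda>L. run P (src L) (adj L) (feat L) \<bullet> run P (tgt L) (adj L) (feat L))"
      by (auto simp: GAE_def)
    \<comment> \<open>Reversal exchanges the arguments of the scalar product, which commutes because
      both have dimension \<open>out_dim P\<close>.\<close>
    have "run P v (adj (L01 F)) (feat (L01 F)) \<in> carrier_vec (out_dim P)" if "v < 2" for v
      using run_carrier[OF P] is_link_edge_link[of 0 1 F] that
      by (auto simp: is_link_def edge_link_def)
    from comm_scalar_prod[OF this[of 0] this[of 1]] show "r (L01 F) = r (L10 F)"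
      by (simp add: r edge_link_def)
  qed
  show "strictly_more_expressive F (Comb F) (NeoGNN F)"
    by (rule strictly_more_expressive_CombI[OF assms Comb_more_expressive_NeoGNN])
      (auto simp: NeoGNN_def pair_rep_edge_swap neo_feature_edge_swap simp del: One_nat_def)
  have "buddy_features k (L10 F) = buddy_features k (L01 F)" for k
    by (rule automorphism.buddy_features_eq[OF automorphism_edge[of F 0 1]])
      (simp_all add: edge_link_def)
  then show "strictly_more_expressive F (Comb F) (BUDDY F)"
    by (intro strictly_more_expressive_CombI[OF assms Comb_more_expressive_BUDDY])
      (auto simp: BUDDY_def pair_rep_edge_swap simp del: One_nat_def)
qed

end
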